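(* Let $a$ be an integer, $v\in\mathbb{C}$, and let $\beta_n^{(a)}(x,v)$ be the polynomials defined by $$\left(\frac{t}{e^t-1}\right)^a e^{xt-\frac{v t^2}{2}}=\sum_{n=0}^\infty \beta_n^{(a)}(x,v)\frac{t^n}{n!}.$$ Then for all $n\in\mathbb{N}_0$, $$\beta_n^{(a)}(x,v)=\sum_{j=0}^n\binom{n}{j}B_j^{(a)}(x)\,H_{n-j}^{(v)}.$$
   Context: $\mathbb{N}_0=\{0,1,2,\dots\}$. All generating functions are formal power series in $t$. The Bernoulli polynomials of order $a$ are defined by $\left(\frac{t}{e^t-1}\right)^a e^{xt}=\sum_{n\ge0}B_n^{(a)}(x)\frac{t^n}{n!}$. The Hermite polynomials $H_n^{(v)}(x)$ are defined by $e^{xt-\frac{vt^2}{2}}=\sum_{n\ge0}H_n^{(v)}(x)\frac{t^n}{n!}$, and $H_n^{(v)}:=H_n^{(v)}(0)$. *)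

theory Defs
  imports "HOL-Computational_Algebra.Computational_Algebra"
begin

unbundle fps_syntax

text \<open>
  Throughout, the variable \<open>t\<close> is \<^const>\<open>fps_X\<close>, the series \<open>exp (x t)\<close> is \<open>fps_exp x\<close>, and
  polynomials in \<open>x\<close> are represented by their values at complex \<open>x\<close>.
\<close>

text \<open>Division of power series removes the common factor \<open>t\<close>; the quotient has constant term 1,
  so integer powers of it are genuine powers also for negative exponents.\<close>

definition bernoulli_kernel :: "complex fps" where
  "bernoulli_kernel = fps_X / (fps_exp 1 - 1)"

definition hermite_gf :: "complex \<Rightarrow> complex \<Rightarrow> complex fps" where
  "hermite_gf v x = fps_exp 1 oo (fps_const x * fps_X - fps_const (v / 2) * fps_X ^ 2)"

definition bernoulli_poly :: "int \<Rightarrow> nat \<Rightarrow> complex \<Rightarrow> complex" where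
  "bernoulli_poly a n x = fact n * (bernoulli_kernel powi a * fps_exp x) $ n"

definition hermite_poly :: "complex \<Rightarrow> nat \<Rightarrow> complex \<Rightarrow> complex" where
  "hermite_poly v n x = fact n * hermite_gf v x $ n"

definition hermite_number :: "complex \<Rightarrow> nat \<Rightarrow> complex" where
  "hermite_number v n = hermite_poly v n 0"

definition beta_poly :: "int \<Rightarrow> nat \<Rightarrow> complex \<Rightarrow> complex \<Rightarrow> complex" where
  "beta_poly a n x v = fact n * (bernoulli_kernel powi a * hermite_gf v x) $ n"

lemma bernoulli_kernel_mult: "bernoulli_kernel * (fps_exp 1 - 1) = fps_X"
proof -
  have ne: "(fps_exp 1 - 1 :: complex fps) $ 1 \<noteq> 0" by simp
  hence nz: "(fps_exp 1 - 1 :: complex fps) \<noteq> 0" by (metis fps_zero_nth)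
  have "subdegree (fps_exp 1 - 1 :: complex fps) \<le> 1"
    using ne by (rule subdegree_leI)
  hence "(fps_exp 1 - 1 :: complex fps) dvd fps_X"
    using nz by (simp add: fps_dvd_iff)
  thus ?thesis by (simp add: bernoulli_kernel_def)
qed

lemma bernoulli_kernel_nth_0: "bernoulli_kernel $ 0 = 1"
proof -
  have "(bernoulli_kernel * (fps_exp 1 - 1)) $ 1 = 1"
    by (simp add: bernoulli_kernel_mult)
  thus ?thesis by (simp add: fps_mult_nth)
qed

lemma bernoulli_kernel_powi_minus:
  "bernoulli_kernel powi (- a) * bernoulli_kernel powi a = 1"
proof -
  have u: "inverse bernoulli_kernel * bernoulli_kernel = 1"
    by (simp add: inverse_mult_eq_1 bernoulli_kernel_nth_0)
  have "inverse bernoulli_kernel ^ n * bernoulli_kernel ^ n = 1" for n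
    by (simp add: u flip: power_mult_distrib)
  thus ?thesis
    by (cases "a = 0") (auto simp: power_int_def mult.commute)
qed

lemma bernoulli_poly_gf:
  "Abs_fps (\<lambda>n. bernoulli_poly a n x / fact n) = bernoulli_kernel powi a * fps_exp x"
  by (simp add: bernoulli_poly_def fps_eq_iff)

lemma hermite_poly_gf:
  "Abs_fps (\<lambda>n. hermite_poly v n x / fact n) = hermite_gf v x"
  by (simp add: hermite_poly_def fps_eq_iff)

lemma beta_poly_gf:
  "Abs_fps (\<lambda>n. beta_poly a n x v / fact n) = bernoulli_kernel powi a * hermite_gf v x"
  by (simp add: beta_poly_def fps_eq_iff)

text \<open>All coefficients depend polynomially on \<open>x\<close>.\<close>

lemma poly_fun_mult_nth:
  fixes F G :: "complex \<Rightarrow> complex fps"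
  assumes "\<And>n. \<exists>p. \<forall>x. F x $ n = poly p x" and "\<And>n. \<exists>p. \<forall>x. G x $ n = poly p x"
  shows "\<exists>p. \<forall>x. (F x * G x) $ n = poly p x"
proof -
  obtain f where f: "\<And>n x. F x $ n = poly (f n) x" using assms(1) by metis
  obtain g where g: "\<And>n x. G x $ n = poly (g n) x" using assms(2) by metis
  show ?thesis
    by (rule exI[of _ "\<Sum>i=0..n. f i * g (n - i)"]) (simp add: fps_mult_nth f g poly_sum)
qed

lemma const_poly_fun: "\<exists>p. \<forall>x::complex. c = poly p x"
  by (rule exI[of _ "[:c:]"]) simp

lemma hermite_gf_nth_poly: "\<exists>p. \<forall>x. hermite_gf v x $ n = poly p x"
proof -
  let ?L = "\<lambda>x. fps_const x * fps_X - fps_const (v / 2) * fps_X ^ 2 :: complex fps"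
  have L: "\<exists>p. \<forall>x. ?L x $ n = poly p x" for n
    by (rule exI[of _ "[:- (if n = 2 then v / 2 else 0), if n = 1 then 1 else 0:]"])
       (simp add: fps_X_power_iff)
  have "\<exists>p. \<forall>x. (?L x ^ i) $ n = poly p x" for i n
  proof (induction i arbitrary: n)
    case 0
    show ?case using const_poly_fun by simp
  next
    case (Suc i)
    show ?case using poly_fun_mult_nth[OF L Suc.IH] by simp
  qed
  then obtain q where q: "\<And>i n x. (?L x ^ i) $ n = poly (q i n) x" by metis
  show ?thesis
    by (rule exI[of _ "\<Sum>i=0..n. smult (fps_exp 1 $ i) (q i n)"])
       (simp add: hermite_gf_def fps_compose_nth q poly_sum)
qed

lemma fps_exp_nth_poly: "\<exists>p. \<forall>x::complex. fps_exp x $ n = poly p x"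
  by (rule exI[of _ "monom (1 / fact n) n"]) (simp add: poly_monom)

lemma bernoulli_poly_is_poly: "\<exists>p. \<forall>x. bernoulli_poly a n x = poly p x"
proof -
  obtain p where "\<forall>x. (bernoulli_kernel powi a * fps_exp x) $ n = poly p x"
    using poly_fun_mult_nth[OF const_poly_fun fps_exp_nth_poly] by blast
  thus ?thesis by (intro exI[of _ "smult (fact n) p"]) (simp add: bernoulli_poly_def)
qed

lemma hermite_poly_is_poly: "\<exists>p. \<forall>x. hermite_poly v n x = poly p x"
proof -
  obtain p where "\<forall>x. hermite_gf v x $ n = poly p x"
    using hermite_gf_nth_poly by blast
  thus ?thesis by (intro exI[of _ "smult (fact n) p"]) (simp add: hermite_poly_def)
qed

lemma beta_poly_is_poly: "\<exists>p. \<forall>x. beta_poly a n x v = poly p x"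
proof -
  obtain p where "\<forall>x. (bernoulli_kernel powi a * hermite_gf v x) $ n = poly p x"
    using poly_fun_mult_nth[OF const_poly_fun hermite_gf_nth_poly] by blast
  thus ?thesis by (intro exI[of _ "smult (fact n) p"]) (simp add: beta_poly_def)
qed

end

theory Submission
  imports Defs
begin

text \<open>
  Since \<open>exp (x t - v t\<^sup>2/2) = exp (x t) exp (- v t\<^sup>2/2)\<close>, the generating function of the
  \<open>\<beta>\<^sub>n\<close> is the product of those of the \<open>B\<^sub>j\<close> and of the Hermite numbers, and its coefficients
  form a binomial convolution.
\<close>

text \<open>Both sides solve \<open>y' = (F' + G') y\<close> with \<open>y(0) = 1\<close>, so their quotient is constant.\<close>

lemma fps_exp_compose_add:
  fixes F G :: "'a::field_char_0 fps"
  assumes F: "F $ 0 = 0" and G: "G $ 0 = 0"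
  shows "fps_exp 1 oo (F + G) = (fps_exp 1 oo F) * (fps_exp 1 oo G)"
proof -
  define E :: "'a fps \<Rightarrow> 'a fps" where "E H = fps_exp 1 oo H" for H
  define Q where "Q = E F * E G"
  have dE: "fps_deriv (E H) = E H * fps_deriv H" if "H $ 0 = 0" for H
    using that by (simp add: E_def fps_compose_deriv)
  have E0: "E H $ 0 = 1" for H
    by (simp add: E_def fps_compose_nth)
  have Q0: "Q $ 0 = 1"
    by (simp add: Q_def E0)
  have dQ: "fps_deriv Q = Q * fps_deriv (F + G)"
    by (simp add: Q_def dE F G algebra_simps)
  have inv: "inverse Q * Q = 1"
    by (simp add: inverse_mult_eq_1 Q0)
  \<comment> \<open>The derivative of \<open>inverse Q\<close> is
    \<open>- fps_deriv Q * inverse Q ^ 2\<close>, so by \<open>dQ\<close> the two product-rule terms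
    differ only by a factor \<open>inverse Q * Q\<close>, which equals 1.\<close>
  have "fps_deriv (E (F + G) * inverse Q) =
      E (F + G) * inverse Q * fps_deriv (F + G) * (1 - inverse Q * Q)"
    by (simp add: fps_inverse_deriv Q0 dQ dE F G power2_eq_square algebra_simps)
  also have "\<dots> = 0"
    by (simp add: inv)
  finally have "E (F + G) * inverse Q = fps_const ((E (F + G) * inverse Q) $ 0)"
    by (simp only: fps_deriv_eq_0_iff)
  hence "E (F + G) * inverse Q = 1"
    by (simp add: E0 Q0)
  hence "E (F + G) * (inverse Q * Q) = Q"
    by (simp only: mult_1_left flip: mult.assoc)
  hence "E (F + G) = Q"
    by (simp only: inv mult_1_right)
  thus ?thesis
    by (simp only: Q_def E_def)
qed

lemma hermite_gf_eq_exp_mult: "hermite_gf v x = fps_exp x * hermite_gf v 0"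
proof -
  let ?F = "fps_const x * fps_X" and ?G = "- (fps_const (v / 2) * fps_X ^ 2) :: complex fps"
  have "hermite_gf v x = fps_exp 1 oo (?F + ?G)"
    by (simp add: hermite_gf_def)
  also have "\<dots> = (fps_exp 1 oo ?F) * (fps_exp 1 oo ?G)"
    by (rule fps_exp_compose_add) simp_all
  \<comment> \<open>At \<open>x = 0\<close> the linear term vanishes, so the second factor is
    \<open>hermite_gf v 0\<close>.\<close>
  also have "\<dots> = fps_exp x * hermite_gf v 0"
    by (simp add: hermite_gf_def)
  finally show ?thesis .
qed

theorem theorem2:
  fixes a :: int and v x :: complex and n :: nat
  shows "beta_poly a n x v =
    (\<Sum>j=0..n. of_nat (n choose j) * bernoulli_poly a j x * hermite_number v (n - j))"
proof -
  have "beta_poly a n x v =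
      fact n * ((bernoulli_kernel powi a * fps_exp x) * hermite_gf v 0) $ n"
    by (simp only: beta_poly_def hermite_gf_eq_exp_mult[of v x] mult.assoc)
  also have "\<dots> = (\<Sum>j=0..n. fact n *
      ((bernoulli_kernel powi a * fps_exp x) $ j * hermite_gf v 0 $ (n - j)))"
    by (simp only: fps_mult_nth[of "bernoulli_kernel powi a * fps_exp x"] sum_distrib_left)
  \<comment> \<open>Termwise, \<open>n! = (n choose j) * j! * (n - j)!\<close> gives each
    coefficient its own factorial.\<close>
  also have "\<dots> =
      (\<Sum>j=0..n. of_nat (n choose j) * bernoulli_poly a j x * hermite_number v (n - j))"
    by (intro sum.cong refl)
       (simp add: bernoulli_poly_def hermite_number_def hermite_poly_def binomial_fact)
  finally show ?thesis .
qed

end
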